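(* Let $\mathcal Q_{d,1}=\mathrm{conv}(A)\subseteq\mathbb R^d$ and $\mathcal Q_{d,2}=\mathrm{conv}(B)\subseteq\mathbb R^d$ be full-dimensional integral simplices, where the columns of $A,B\in\mathbb R^{d\times(d+1)}$ are the vertices. For an integer $n>d$, let $\mathcal Q^n_{d,1}=\mathrm{conv}(C)$ and $\mathcal Q^n_{d,2}=\mathrm{conv}(D)\subseteq\mathbb R^n$ where $$C=\begin{pmatrix}A&\mathbf 0_{d\times(n-d)}\\ \mathbf 0_{(n-d)\times(d+1)}&I_{n-d}\end{pmatrix},\qquad D=\begin{pmatrix}B&\mathbf 0_{d\times(n-d)}\\ \mathbf 0_{(n-d)\times(d+1)}&I_{n-d}\end{pmatrix}$$ (i.e. the $n$-dimensional pyramids obtained by embedding the simplices in $\mathbb R^n$ and adjoining the vertices $\mathbf e_{d+1},\dots,\mathbf e_n$). Then $\mathcal Q_{d,1}$ and $\mathcal Q_{d,2}$ are unimodularly equivalent if and only if $\mathcal Q^n_{d,1}$ and $\mathcal Q^n_{d,2}$ are unimodularly equivalent.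
   Context: Two polytopes $\mathcal P,\mathcal Q\subseteq\mathbb R^k$ are unimodularly equivalent if there are $U\in\mathrm{GL}_k(\mathbb Z)$ (integer matrices of determinant $\pm1$) and $\mathbf b\in\mathbb Z^k$ such that $\{U\mathbf x+\mathbf b:\mathbf x\in\mathcal P\}=\mathcal Q$. *)

theory Defs
  imports "HOL-Analysis.Analysis"
begin

definition integral_polytope :: "(real ^ 'k) set \<Rightarrow> bool" where
  "integral_polytope P \<longleftrightarrow>
     polytope P \<and> (\<forall>v. v extreme_point_of P \<longrightarrow> (\<forall>i. v $ i \<in> \<int>))"

definition unimodularly_equivalent :: "(real ^ 'k) set \<Rightarrow> (real ^ 'k) set \<Rightarrow> bool" where
  "unimodularly_equivalent P Q \<longleftrightarrow>
     (\<exists>(U :: real ^ 'k ^ 'k) (b :: real ^ 'k).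
        (\<forall>i j. U $ i $ j \<in> \<int>) \<and> (det U = 1 \<or> det U = - 1) \<and>
        (\<forall>i. b $ i \<in> \<int>) \<and>
        (\<lambda>x. U *v x + b) ` P = Q)"

text \<open>
  The block matrix with rows (P Q) and (R S). Coordinates of the large space are indexed by a
  sum type, so that for \<open>'d\<close> of cardinality d and \<open>'m\<close> of cardinality n - d (positive, as types
  are nonempty) the type \<open>real ^ ('d + 'm)\<close> is n-dimensional space with n > d.
\<close>

definition block_matrix ::
  "real ^ 'c1 ^ 'r1 \<Rightarrow> real ^ 'c2 ^ 'r1 \<Rightarrow> real ^ 'c1 ^ 'r2 \<Rightarrow> real ^ 'c2 ^ 'r2
     \<Rightarrow> real ^ ('c1 + 'c2) ^ ('r1 + 'r2)" where
  "block_matrix P Q R S = (\<chi> i j.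
     case i of
       Inl r \<Rightarrow> (case j of Inl c \<Rightarrow> P $ r $ c | Inr c \<Rightarrow> Q $ r $ c)
     | Inr r \<Rightarrow> (case j of Inl c \<Rightarrow> R $ r $ c | Inr c \<Rightarrow> S $ r $ c))"

end

theory Submission
  imports Defs
begin

text \<open>
  A unimodular equivalence is an affine map that permutes the integer points. It carries the
  vertices of one pyramid to those of the other, but may mix apexes with base vertices. If
  \<open>p\<close> and \<open>q\<close> are integral vertices of a simplex whose barycentric coordinate functions
  \<open>h\<^sub>p\<close>, \<open>h\<^sub>q\<close> take integer values at integer points, then
  \<open>x \<mapsto> x + (h\<^sub>p x - h\<^sub>q x) (q - p)\<close> is an integral affine involution that swaps \<open>p\<close> and \<open>q\<close> and
  fixes the other vertices. The apexes, and the images of apexes under a unimodular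
  equivalence, are vertices of this kind, so finitely many swaps make the equivalence preserve
  the set of apexes. It then restricts to the affine hulls of the bases.
\<close>

section \<open>Affine maps permuting the integer points\<close>

definition integer_points :: "(real ^ 'k) set" where
  "integer_points = {x. \<forall>i. x $ i \<in> \<int>}"

text \<open>A matrix-free form of unimodular transformations: equality of the image, not mere
  inclusion, takes over the role of the determinant condition, so composition and inversion need no
  matrices.\<close>

definition lattice_affine :: "(real ^ 'k \<Rightarrow> real ^ 'k) \<Rightarrow> bool" where
  "lattice_affine f \<longleftrightarrow> linear (\<lambda>x. f x - f 0) \<and> f ` integer_points = integer_points"

lemma zero_integer_points [simp]: "0 \<in> integer_points"
  by (simp add: integer_points_def)

lemma integer_points_add: "x \<in> integer_points \<Longrightarrow> y \<in> integer_points \<Longrightarrow> x + y \<in> integer_points"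
  by (simp add: integer_points_def)

lemma integer_points_diff: "x \<in> integer_points \<Longrightarrow> y \<in> integer_points \<Longrightarrow> x - y \<in> integer_points"
  by (simp add: integer_points_def)

lemma integer_points_scaleR: "c \<in> \<int> \<Longrightarrow> x \<in> integer_points \<Longrightarrow> c *\<^sub>R x \<in> integer_points"
  by (simp add: integer_points_def)

lemma integer_points_axis [simp]: "axis i 1 \<in> integer_points"
  by (simp add: integer_points_def axis_def)

lemma integer_pointsD: "x \<in> integer_points \<Longrightarrow> x $ i \<in> \<int>"
  by (simp add: integer_points_def)

lemma det_Ints:
  fixes U :: "real ^ 'k ^ 'k"
  assumes "\<And>i j. U $ i $ j \<in> \<int>"
  shows "det U \<in> \<int>"
  unfolding det_def using assms by (auto intro!: Ints_sum Ints_mult Ints_prod)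

lemma affine_map_convex_hull:
  fixes f :: "'a::euclidean_space \<Rightarrow> 'b::euclidean_space"
  assumes "linear (\<lambda>x. f x - f 0)"
  shows "f ` (convex hull S) = convex hull (f ` S)"
proof -
  have *: "f ` X = (+) (f 0) ` (\<lambda>x. f x - f 0) ` X" for X
    by (simp add: image_image)
  show ?thesis
    by (simp only: * convex_hull_linear_image[OF assms] convex_hull_translation)
qed

lemma affine_map_affine_hull:
  fixes f :: "'a::euclidean_space \<Rightarrow> 'b::euclidean_space"
  assumes "linear (\<lambda>x. f x - f 0)"
  shows "f ` (affine hull S) = affine hull (f ` S)"
proof -
  have *: "f ` X = (+) (f 0) ` (\<lambda>x. f x - f 0) ` X" for X
    by (simp add: image_image)
  have "bounded_linear (\<lambda>x. f x - f 0)"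
    using assms by (simp add: linear_conv_bounded_linear)
  from affine_hull_linear_image[OF this] show ?thesis
    by (simp only: * affine_hull_translation)
qed

text \<open>Since \<open>f 0\<close> is itself an integer point, the linear part inherits
  surjectivity on integer points: take an integer preimage of \<open>z + f 0\<close>.\<close>

lemma lattice_affine_linear_surj:
  assumes "lattice_affine f" "z \<in> integer_points"
  obtains x where "x \<in> integer_points" "f x - f 0 = z"
proof -
  have "f 0 \<in> integer_points"
    using assms by (auto simp: lattice_affine_def)
  then have "z + f 0 \<in> f ` integer_points"
    using assms by (simp add: lattice_affine_def integer_points_add)
  then obtain x where "x \<in> integer_points" "f x = z + f 0"
    by (metis imageE)
  then show thesis
    using that by simp
qed

text \<open>The linear part reaches every unit vector, hence is onto, and a surjective linear
  endomorphism in finite dimension is injective.\<close>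

lemma lattice_affine_bij:
  assumes "lattice_affine f"
  shows "bij f"
proof -
  let ?L = "\<lambda>x. f x - f 0"
  have lin: "linear ?L"
    using assms by (simp add: lattice_affine_def)
  have "axis i 1 \<in> range ?L" for i
    using lattice_affine_linear_surj[OF assms integer_points_axis[of i]] by (metis rangeI)
  then have "(Basis :: (real^'a) set) \<subseteq> range ?L"
    by (auto simp: Basis_vec_def)
  then have "span (Basis :: (real^'a) set) \<subseteq> range ?L"
    by (rule span_minimal) (simp add: lin linear_subspace_image)
  then have surj: "surj ?L"
    by auto
  then have "inj ?L"
    using lin linear_surjective_imp_injective by blast
  then have "inj f"
    by (auto simp: inj_def)
  moreover have "y \<in> range f" for y
  proof -
    have "y - f 0 \<in> range ?L"
      using surj by simp
    then obtain x where "y - f 0 = ?L x"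
      by blast
    then show ?thesis
      by simp
  qed
  then have "surj f"
    by blast
  ultimately show ?thesis
    by (simp add: bij_def)
qed

lemma lattice_affine_compose:
  assumes "lattice_affine f" "lattice_affine g"
  shows "lattice_affine (g \<circ> f)"
proof -
  have g: "linear (\<lambda>x. g x - g 0)" and f: "linear (\<lambda>x. f x - f 0)"
    using assms by (simp_all add: lattice_affine_def)
  have "g (f x) - g (f 0) = g (f x - f 0) - g 0" for x
    using linear_diff[OF g, of "f x" "f 0"] by simp
  moreover have "linear ((\<lambda>x. g x - g 0) \<circ> (\<lambda>x. f x - f 0))"
    using f g by (rule linear_compose)
  ultimately show ?thesis
    using assms by (simp add: lattice_affine_def o_def flip: image_image)
qed

lemma lattice_affine_inv:
  assumes "lattice_affine f"
  shows "lattice_affine (inv f)"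
proof -
  have bij: "bij f" and f: "linear (\<lambda>x. f x - f 0)"
    using assms by (simp_all add: lattice_affine_bij lattice_affine_def)
  have fi: "f (inv f x) = x" for x
    using bij by (simp add: bij_is_surj surj_f_inv_f)
  have inj: "f x = f y \<Longrightarrow> x = y" for x y
    using bij by (simp add: bij_is_inj inj_eq)
  \<comment> \<open>With this formula, additivity and homogeneity of the linear part of
    \<open>inv f\<close> can be checked after applying the injective map \<open>f\<close>.\<close>
  have fd: "f (inv f x - inv f 0) = x + f 0" for x
    using linear_diff[OF f, of "inv f x" "inv f 0"] by (simp add: fi diff_eq_eq)
  have "linear (\<lambda>x. inv f x - inv f 0)"
  proof (rule linearI)
    fix x y
    show "inv f (x + y) - inv f 0 = (inv f x - inv f 0) + (inv f y - inv f 0)"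
      by (rule inj) (use linear_add[OF f, of "inv f x - inv f 0" "inv f y - inv f 0"] in
        \<open>simp add: fd diff_eq_eq\<close>)
  next
    fix c x
    show "inv f (c *\<^sub>R x) - inv f 0 = c *\<^sub>R (inv f x - inv f 0)"
      by (rule inj) (use linear_scale[OF f, of c "inv f x - inv f 0"] in
        \<open>simp add: fd algebra_simps\<close>)
  qed
  moreover have "inv f ` integer_points = integer_points"
    using assms bij by (metis bij_is_inj image_inv_f_f lattice_affine_def)
  ultimately show ?thesis
    by (simp add: lattice_affine_def)
qed

section \<open>Correspondence with integer matrices of determinant 1 or -1\<close>

lemma unimodular_matrix_lattice_affine:
  fixes U :: "real ^ 'k ^ 'k" and b :: "real ^ 'k"
  assumes U: "\<And>i j. U $ i $ j \<in> \<int>" and det: "det U = 1 \<or> det U = - 1"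
    and b: "b \<in> integer_points"
  shows "lattice_affine (\<lambda>x. U *v x + b)"
proof -
  have "U *v x + b \<in> integer_points" if "x \<in> integer_points" for x
    using that U b by (auto simp: integer_points_def matrix_vector_mult_def intro!: Ints_sum Ints_add)
  moreover have "z \<in> (\<lambda>x. U *v x + b) ` integer_points" if z: "z \<in> integer_points" for z
  proof -
    \<comment> \<open>Cramer's rule solves \<open>U *v x = z - b\<close>; the numerators are
      determinants of integer matrices, and dividing by 1 or -1 keeps them integers.\<close>
    define x where "x = (\<chi> k. det (\<chi> i j. if j = k then (z - b) $ i else U $ i $ j) / det U)"
    have "U *v x = z - b"
      using cramer[of U x "z - b"] det unfolding x_def by auto
    moreover have "det (\<chi> i j. if j = k then (z - b) $ i else U $ i $ j) \<in> \<int>" for k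
      using U integer_points_diff[OF z b] by (intro det_Ints) (auto simp: integer_points_def)
    then have "x \<in> integer_points"
      using det by (auto simp: integer_points_def x_def)
    ultimately show ?thesis
      by (metis (no_types, lifting) diff_add_cancel image_eqI)
  qed
  ultimately show ?thesis
    by (auto simp: lattice_affine_def)
qed

text \<open>Integer preimages of the unit vectors under the linear part are the columns of an
  integer right inverse \<open>V\<close> of \<open>U\<close>. The two determinants are integers with
  product 1, so each is 1 or -1.\<close>

lemma lattice_affine_imp_unimodular_matrix:
  fixes f :: "real ^ 'k \<Rightarrow> real ^ 'k"
  assumes "lattice_affine f"
  obtains U :: "real ^ 'k ^ 'k" and b where
    "\<And>i j. U $ i $ j \<in> \<int>" "det U = 1 \<or> det U = - 1" "b \<in> integer_points"
    "f = (\<lambda>x. U *v x + b)"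
proof -
  let ?L = "\<lambda>x. f x - f 0"
  have L: "linear ?L"
    using assms by (simp add: lattice_affine_def)
  have fZ: "x \<in> integer_points \<Longrightarrow> f x \<in> integer_points" for x
    using assms by (auto simp: lattice_affine_def)
  define U where "U = matrix ?L"
  have Uv: "U *v x = f x - f 0" for x
    unfolding U_def using matrix_works[of ?L x] L
    by (simp add: linear_matrix_vector_mul_eq)
  have U: "U $ i $ j \<in> \<int>" for i j
    using integer_pointsD[OF integer_points_diff[OF fZ[OF integer_points_axis[of j]] fZ[of 0]], of i]
    by (simp add: U_def matrix_def)
  have "\<exists>x. x \<in> integer_points \<and> U *v x = axis j 1" for j
    using lattice_affine_linear_surj[OF assms integer_points_axis[of j]] Uv by metis
  then obtain w where w: "\<And>j. w j \<in> integer_points" "\<And>j. U *v w j = axis j 1"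
    by metis
  define V :: "real ^ 'k ^ 'k" where "V = (\<chi> i j. w j $ i)"
  have V: "V $ i $ j \<in> \<int>" for i j
    using w(1) by (simp add: V_def integer_points_def)
  have "(U ** V) $ i $ j = (U *v w j) $ i" for i j
    by (simp add: V_def matrix_matrix_mult_def matrix_vector_mult_def)
  then have "U ** V = mat 1"
    by (simp add: vec_eq_iff w(2) mat_def axis_def)
  then have prod: "det U * det V = 1"
    by (metis det_I det_mul)
  obtain a b where ab: "det U = of_int a" "det V = of_int b"
    using det_Ints[of U] det_Ints[of V] U V by (metis Ints_cases)
  with prod have "a * b = 1"
    by (metis of_int_eq_1_iff of_int_mult)
  then have "det U = 1 \<or> det U = - 1"
    using ab by (auto simp: zmult_eq_1_iff)
  with U show thesis
    using that[of U "f 0"] fZ[of 0] Uv by simp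
qed

lemma unimodularly_equivalent_iff_lattice_affine:
  "unimodularly_equivalent P Q \<longleftrightarrow> (\<exists>f. lattice_affine f \<and> f ` P = Q)"
proof
  assume "unimodularly_equivalent P Q"
  then obtain U b where Ub: "\<And>i j. U $ i $ j \<in> \<int>" "det U = 1 \<or> det U = - 1"
      "b \<in> integer_points" and img: "(\<lambda>x. U *v x + b) ` P = Q"
    unfolding unimodularly_equivalent_def integer_points_def by blast
  show "\<exists>f. lattice_affine f \<and> f ` P = Q"
    using unimodular_matrix_lattice_affine[OF Ub] img by blast
next
  assume "\<exists>f. lattice_affine f \<and> f ` P = Q"
  then obtain f where f: "lattice_affine f" "f ` P = Q"
    by blast
  from f(1) obtain U b where "\<And>i j. U $ i $ j \<in> \<int>" "det U = 1 \<or> det U = - 1"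
      "b \<in> integer_points" "f = (\<lambda>x. U *v x + b)"
    by (rule lattice_affine_imp_unimodular_matrix) blast
  with f(2) show "unimodularly_equivalent P Q"
    unfolding unimodularly_equivalent_def integer_points_def by blast
qed

section \<open>Iterated pyramids\<close>

definition embed_base :: "real ^ 'd \<Rightarrow> real ^ ('d::finite + 'm::finite)" where
  "embed_base x = (\<chi> i. case i of Inl a \<Rightarrow> x $ a | Inr _ \<Rightarrow> 0)"

definition base_part :: "real ^ ('d::finite + 'm::finite) \<Rightarrow> real ^ 'd" where
  "base_part v = (\<chi> a. v $ Inl a)"

definition apexes :: "(real ^ ('d::finite + 'm::finite)) set" where
  "apexes = range (\<lambda>j. axis (Inr j) 1)"

lemma embed_nth [simp]: "embed_base x $ Inl a = x $ a" "embed_base x $ Inr j = 0"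
  by (simp_all add: embed_base_def)

lemma base_part_nth [simp]: "base_part v $ a = v $ Inl a"
  by (simp add: base_part_def)

lemma vec_sum_eq_iff:
  fixes v w :: "real ^ ('d::finite + 'm::finite)"
  shows "v = w \<longleftrightarrow> (\<forall>a. v $ Inl a = w $ Inl a) \<and> (\<forall>j. v $ Inr j = w $ Inr j)"
  by (metis (no_types) sum.exhaust vec_eq_iff)

lemma base_part_embed [simp]: "base_part (embed_base x) = x"
  by (simp add: vec_eq_iff)

lemma linear_embed: "linear embed_base"
  by (rule linearI) (simp_all add: vec_sum_eq_iff)

lemma linear_base_part: "linear base_part"
  by (rule linearI) (simp_all add: vec_eq_iff)

lemma inj_embed: "inj embed_base"
  by (metis base_part_embed injI)

lemma embed_integer_points: "embed_base x \<in> integer_points \<longleftrightarrow> x \<in> integer_points"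
  unfolding integer_points_def mem_Collect_eq
  by (metis (no_types) Ints_0 embed_nth sum.exhaust)

lemma base_part_integer_points: "v \<in> integer_points \<Longrightarrow> base_part v \<in> integer_points"
  by (simp add: integer_points_def)

lemma embed_notin_apexes: "(embed_base x :: real ^ ('d::finite + 'm::finite)) \<notin> apexes"
proof
  assume "(embed_base x :: real ^ ('d + 'm)) \<in> apexes"
  then obtain j where "(embed_base x :: real ^ ('d + 'm)) = axis (Inr j) 1"
    by (auto simp: apexes_def)
  from arg_cong[OF this, of "\<lambda>v. v $ Inr j"] show False
    by simp
qed

section \<open>Vertex sets of the pyramids\<close>

lemma columns_pyramid:
  fixes A :: "real ^ 'k ^ 'd"
  shows "columns (block_matrix A 0 0 (mat 1) :: real ^ ('k::finite + 'm::finite) ^ ('d + 'm)) =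
    embed_base ` columns A \<union> apexes"
proof -
  let ?M = "block_matrix A 0 0 (mat 1) :: real ^ ('k + 'm) ^ ('d + 'm)"
  have "column (Inl a) ?M = embed_base (column a A)" for a
    by (simp add: vec_sum_eq_iff column_def block_matrix_def)
  moreover have "column (Inr j) ?M = axis (Inr j) 1" for j
    by (simp add: vec_sum_eq_iff column_def block_matrix_def mat_def axis_def)
  moreover have "columns ?M = range (\<lambda>i. column i ?M)"
    by (auto simp: columns_def)
  moreover have "columns A = range (\<lambda>i. column i A)"
    by (auto simp: columns_def)
  ultimately show ?thesis
    by (simp add: UNIV_sum image_Un image_image apexes_def)
qed

lemma card_pyramid:
  assumes "finite S"
  shows "card (embed_base ` S \<union> (apexes :: (real ^ ('d::finite + 'm::finite)) set)) = card S + CARD('m)"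
proof -
  have "inj (\<lambda>j. axis (Inr j) 1 :: real ^ ('d + 'm))"
    by (auto simp: inj_def axis_eq_axis)
  then have "card (apexes :: (real ^ ('d + 'm)) set) = CARD('m)"
    "finite (apexes :: (real ^ ('d + 'm)) set)"
    by (simp_all add: apexes_def card_image)
  moreover have "embed_base ` S \<inter> (apexes :: (real ^ ('d + 'm)) set) = {}"
    using embed_notin_apexes by auto
  moreover have "card (embed_base ` S :: (real ^ ('d + 'm)) set) = card S"
    using inj_embed by (metis card_image inj_on_subset subset_UNIV)
  ultimately show ?thesis
    using assms by (simp add: card_Un_disjoint)
qed

lemma affine_coordinate_zero: "affine {v :: real ^ 'n. v $ i = 0}"
  by (simp add: affine_def)

text \<open>Apexes are adjoined one at a time. The new one has coordinate 1 in a direction where all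
  earlier points, and so their affine hull, have coordinate 0.\<close>

lemma affine_independent_pyramid:
  assumes "\<not> affine_dependent S"
  shows "\<not> affine_dependent (embed_base ` S \<union> (apexes :: (real ^ ('d::finite + 'm::finite)) set))"
proof -
  have "\<not> affine_dependent (embed_base ` S \<union> (\<lambda>j. axis (Inr j) 1) ` J :: (real ^ ('d + 'm)) set)" for J
  proof (induction J rule: finite_induct[OF finite_class.finite])
    case 1
    have "card (embed_base ` S :: (real ^ ('d + 'm)) set) = card S"
      using inj_embed by (metis card_image inj_on_subset subset_UNIV)
    then show ?case
      using assms by (simp add: affine_independent_iff_card linear_embed inj_embed)
  next
    case (2 i J)
    have "embed_base ` S \<union> (\<lambda>j. axis (Inr j) 1) ` J \<subseteq> {v :: real ^ ('d + 'm). v $ Inr i = 0}"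
      using 2 by (auto simp: axis_def)
    then have "affine hull (embed_base ` S \<union> (\<lambda>j. axis (Inr j) 1) ` J)
        \<subseteq> {v :: real ^ ('d + 'm). v $ Inr i = 0}"
      by (simp add: hull_minimal affine_coordinate_zero)
    then have "axis (Inr i) 1 \<notin>
        affine hull (embed_base ` S \<union> (\<lambda>j. axis (Inr j) 1) ` J :: (real ^ ('d + 'm)) set)"
      by auto
    with 2 show ?case
      by (simp add: affine_independent_insert)
  qed
  then show ?thesis
    by (simp add: apexes_def)
qed

section \<open>From the bases to the pyramids\<close>

lemma lattice_affine_extend:
  fixes f :: "real ^ 'd \<Rightarrow> real ^ 'd"
  assumes "lattice_affine f"
  obtains F :: "real ^ ('d::finite + 'm::finite) \<Rightarrow> real ^ ('d + 'm)" where
    "lattice_affine F" "\<And>x. F (embed_base x) = embed_base (f x)" "\<And>v. v \<in> apexes \<Longrightarrow> F v = v"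
proof -
  have lin: "linear (\<lambda>x. f x - f 0)" and fZ: "f ` integer_points = integer_points"
    using assms by (simp_all add: lattice_affine_def)
  have f0: "f 0 \<in> integer_points"
    using fZ by auto
  \<comment> \<open>\<open>s\<close> is 0 on the embedded base and 1 at every apex. An apex has base
    part 0, which \<open>f\<close> would move to \<open>f 0\<close>; the multiple of
    \<open>f 0\<close> subtracted in \<open>F\<close> cancels this translation there and changes
    nothing on the base.\<close>
  define s :: "real ^ ('d + 'm) \<Rightarrow> real" where "s v = (\<Sum>j\<in>UNIV. v $ Inr j)" for v
  define F :: "real ^ ('d + 'm) \<Rightarrow> real ^ ('d + 'm)" where
    "F v = v + embed_base (f (base_part v) - base_part v - s v *\<^sub>R f 0)" for v
  have s: "s (v + w) = s v + s w" "s (c *\<^sub>R v) = c * s v" for v w c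
    by (simp_all add: s_def sum.distrib sum_distrib_left)
  have s0: "s (embed_base x) = 0" "s 0 = 0" for x
    by (simp_all add: s_def)
  have b0: "base_part 0 = 0"
    by (simp add: vec_eq_iff)
  have Fl: "F v - F 0 = v + embed_base ((f (base_part v) - f 0) - base_part v - s v *\<^sub>R f 0)" for v
    by (simp add: F_def s0 b0 vec_sum_eq_iff)
  have "linear (\<lambda>v. F v - F 0)"
  proof (rule linearI)
    fix v w :: "real ^ ('d + 'm)"
    have fa: "f (base_part v + base_part w) = f (base_part v) + f (base_part w) - f 0"
      using linear_add[OF lin, of "base_part v" "base_part w"] by (simp add: algebra_simps)
    show "F (v + w) - F 0 = (F v - F 0) + (F w - F 0)"
      by (simp add: fa Fl s linear_add[OF linear_base_part] vec_sum_eq_iff algebra_simps)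
  next
    fix c and v :: "real ^ ('d + 'm)"
    have fs: "f (c *\<^sub>R base_part v) = c *\<^sub>R (f (base_part v) - f 0) + f 0"
      using linear_scale[OF lin, of c "base_part v"] by (simp add: algebra_simps)
    show "F (c *\<^sub>R v) - F 0 = c *\<^sub>R (F v - F 0)"
      by (simp add: fs Fl s linear_scale[OF linear_base_part] vec_sum_eq_iff algebra_simps)
  qed
  moreover have sZ: "s v \<in> \<int>" if "v \<in> integer_points" for v
    using that by (auto simp: s_def integer_points_def)
  have "F v \<in> integer_points" if v: "v \<in> integer_points" for v
  proof -
    have "f (base_part v) \<in> integer_points"
      using base_part_integer_points[OF v] fZ by auto
    then show ?thesis
      unfolding F_def
      by (intro integer_points_add v iffD2[OF embed_integer_points] integer_points_diff
          base_part_integer_points integer_points_scaleR sZ f0)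
  qed
  moreover have "w \<in> F ` integer_points" if w: "w \<in> integer_points" for w
  proof -
    \<comment> \<open>To solve \<open>F v = w\<close>, note that \<open>F\<close> leaves the
      \<open>Inr\<close> coordinates alone, so \<open>s v\<close> must equal \<open>s w\<close>, and
      the base part of \<open>v\<close> must be a preimage under \<open>f\<close> of this
      point.\<close>
    have "base_part w + s w *\<^sub>R f 0 \<in> integer_points"
      using w by (intro integer_points_add base_part_integer_points integer_points_scaleR sZ f0)
    then obtain x where x: "x \<in> integer_points" "f x = base_part w + s w *\<^sub>R f 0"
      using fZ by (metis imageE)
    define v where "v = w + embed_base (x - base_part w)"
    have "v \<in> integer_points"
      unfolding v_def using w x(1)
      by (intro integer_points_add iffD2[OF embed_integer_points] integer_points_diff
          base_part_integer_points)
    moreover have "base_part v = x"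
      by (simp add: v_def vec_eq_iff)
    moreover have "s v = s w"
      by (simp add: v_def s s0)
    ultimately have "F v = w"
      by (simp add: F_def x(2)) (simp add: v_def vec_sum_eq_iff)
    with \<open>v \<in> integer_points\<close> show ?thesis
      by auto
  qed
  ultimately have "lattice_affine F"
    by (auto simp: lattice_affine_def)
  moreover have "F (embed_base x) = embed_base (f x)" for x
    by (simp add: F_def s0 vec_sum_eq_iff)
  moreover have "F v = v" if v: "v \<in> apexes" for v
  proof -
    obtain j where j: "v = axis (Inr j) 1"
      using v by (auto simp: apexes_def)
    have "base_part v = 0"
      by (simp add: j vec_eq_iff axis_def)
    moreover have "s v = 1"
      by (simp add: j s_def axis_def)
    ultimately show ?thesis
      by (simp add: F_def vec_sum_eq_iff)
  qed
  ultimately show thesis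
    using that by blast
qed

lemma unimodularly_equivalent_pyramids:
  fixes S T :: "(real ^ 'd) set"
  assumes "unimodularly_equivalent (convex hull S) (convex hull T)"
  shows "unimodularly_equivalent
    (convex hull (embed_base ` S \<union> (apexes :: (real ^ ('d::finite + 'm::finite)) set)))
    (convex hull (embed_base ` T \<union> apexes))"
proof -
  obtain f where f: "lattice_affine f" "f ` (convex hull S) = convex hull T"
    using assms by (auto simp: unimodularly_equivalent_iff_lattice_affine)
  obtain F :: "real ^ ('d + 'm) \<Rightarrow> real ^ ('d + 'm)" where F: "lattice_affine F"
    "\<And>x. F (embed_base x) = embed_base (f x)" "\<And>v. v \<in> apexes \<Longrightarrow> F v = v"
    by (rule lattice_affine_extend[OF f(1)]) blast
  \<comment> \<open>The hypothesis relates the convex hulls and not the sets \<open>S\<close> and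
    \<open>T\<close>, so each base vertex set is first replaced by the whole base.\<close>
  have hull: "convex hull (embed_base ` X \<union> apexes) =
    convex hull (embed_base ` (convex hull X) \<union> (apexes :: (real ^ ('d + 'm)) set))"
    for X :: "(real ^ 'd) set"
    unfolding convex_hull_linear_image[OF linear_embed] by (rule hull_Un_left)
  have "F ` (embed_base ` (convex hull S) \<union> apexes) = embed_base ` (convex hull T) \<union> apexes"
    using F(2,3) f(2)[symmetric] by (simp add: image_Un image_image)
  then have "F ` (convex hull (embed_base ` S \<union> apexes)) = convex hull (embed_base ` T \<union> apexes)"
    unfolding hull[of S] hull[of T] using affine_map_convex_hull[of F] F(1)
    by (simp only: lattice_affine_def)
  with F(1) show ?thesis
    by (auto simp: unimodularly_equivalent_iff_lattice_affine)
qed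

section \<open>From the pyramids to the bases\<close>

lemma swap_apex:
  fixes f :: "real ^ ('d::finite + 'm::finite) \<Rightarrow> real ^ ('d + 'm)"
  assumes f: "lattice_affine f" and img: "f ` (embed_base ` S \<union> apexes) = embed_base ` T \<union> apexes"
    and q: "q \<in> f ` apexes" "q \<notin> apexes" and p: "p \<in> apexes" "p \<notin> f ` apexes"
  obtains g where "lattice_affine g" "g ` (embed_base ` T \<union> apexes) = embed_base ` T \<union> apexes"
    "g q = p" "\<And>w. w \<in> embed_base ` T \<union> apexes \<Longrightarrow> w \<noteq> p \<Longrightarrow> w \<noteq> q \<Longrightarrow> g w = w"
proof -
  let ?W = "embed_base ` T \<union> (apexes :: (real ^ ('d + 'm)) set)"
  obtain i where i: "q = f (axis (Inr i) 1)"
    using q by (auto simp: apexes_def)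
  obtain j where j: "p = axis (Inr j) 1"
    using p by (auto simp: apexes_def)
  have bij: "bij f"
    by (rule lattice_affine_bij[OF f])
  have invf: "inv f (f x) = x" for x
    using bij by (simp add: bij_is_inj)
  have laf: "lattice_affine (inv f)"
    by (rule lattice_affine_inv[OF f])
  then have lin: "linear (\<lambda>x. inv f x - inv f 0)"
    by (simp add: lattice_affine_def)
  have Z: "inv f x \<in> integer_points" if "x \<in> integer_points" for x
    using laf that by (auto simp: lattice_affine_def)
  \<comment> \<open>The \<open>Inr i\<close> coordinate is the barycentric coordinate of the apex
    \<open>axis (Inr i) 1\<close> in the first pyramid. Transported by \<open>inv f\<close> it
    becomes the one of \<open>q\<close> in the second, with integer values at integer points. The
    coordinate function of \<open>p\<close> is simply \<open>x $ Inr j\<close>.\<close>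
  define h where "h x = inv f x $ Inr i" for x
  have hd: "h (x + c *\<^sub>R (y - z)) = h x + c * (h y - h z)" for x y z c
  proof -
    have 1: "inv f (x + c *\<^sub>R (y - z)) - inv f 0
        = (inv f x - inv f 0) + c *\<^sub>R ((inv f y - inv f 0) - (inv f z - inv f 0))"
      using linear_add[OF lin, of x "c *\<^sub>R (y - z)"] linear_scale[OF lin, of c "y - z"]
        linear_diff[OF lin, of y z] by metis
    show ?thesis
      using arg_cong[OF 1, of "\<lambda>v. v $ Inr i"] by (simp add: h_def)
  qed
  have pW: "p \<in> ?W" and qW: "q \<in> ?W"
    using p q img by auto
  have hW: "h w = 0" if w: "w \<in> ?W" "w \<noteq> q" for w
  proof -
    obtain v where v: "v \<in> embed_base ` S \<union> apexes" "w = f v"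
      using w img by (metis imageE)
    then have "v \<noteq> axis (Inr i) 1"
      using w i by auto
    with v show ?thesis
      by (auto simp: h_def invf apexes_def axis_def)
  qed
  have pj: "w $ Inr j = 0" if "w \<in> ?W" "w \<noteq> p" for w
    using that j by (auto simp: apexes_def axis_def)
  have pq: "p \<noteq> q"
    using p q by auto
  have vals: "h q = 1" "h p = 0" "q $ Inr j = 0" "p $ Inr j = 1"
    using hW[OF pW pq] pj[OF qW] pq by (simp_all add: h_def i j invf)
  define g where "g x = x + (x $ Inr j - h x) *\<^sub>R (q - p)" for x
  \<comment> \<open>A shift by a multiple of \<open>q - p\<close> changes \<open>h\<close> and the
    \<open>Inr j\<close> coordinate by opposite amounts; the multiple is chosen so that their values
    are exchanged, and a second application undoes the first.\<close>
  have gg: "g (g x) = x" for x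
  proof -
    have "h (g x) = x $ Inr j"
      using hd[of x _ q p] by (simp add: g_def vals)
    moreover have "g x $ Inr j = h x"
      by (simp add: g_def vals)
    ultimately have "g (g x) = g x + (h x - x $ Inr j) *\<^sub>R (q - p)"
      by (simp add: g_def[of "g x"])
    then show ?thesis
      by (simp add: g_def algebra_simps)
  qed
  have gW: "g w = w" if "w \<in> ?W" "w \<noteq> p" "w \<noteq> q" for w
    using that hW pj by (simp add: g_def)
  have gq: "g q = p" and gp: "g p = q"
    by (simp_all add: g_def vals)
  have gl: "g x - g 0 = x + (x $ Inr j - (inv f x - inv f 0) $ Inr i) *\<^sub>R (q - p)" for x
    by (simp add: g_def h_def algebra_simps)
  have "linear (\<lambda>x. g x - g 0)"
  proof (rule linearI)
    fix x y
    show "g (x + y) - g 0 = (g x - g 0) + (g y - g 0)"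
      unfolding gl linear_add[OF lin, of x y] by (simp add: vec_eq_iff algebra_simps)
  next
    fix c x
    show "g (c *\<^sub>R x) - g 0 = c *\<^sub>R (g x - g 0)"
      unfolding gl linear_scale[OF lin, of c x] by (simp add: vec_eq_iff algebra_simps)
  qed
  moreover have gZ: "g x \<in> integer_points" if x: "x \<in> integer_points" for x
  proof -
    have "q \<in> integer_points"
      using f by (auto simp: i lattice_affine_def)
    moreover have "p \<in> integer_points"
      by (simp add: j)
    ultimately show ?thesis
      unfolding g_def h_def using x
      by (intro integer_points_add integer_points_scaleR integer_points_diff Ints_diff
          integer_pointsD Z)
  qed
  \<comment> \<open>An involution that maps a set into itself maps it onto itself; the same argument
    serves for \<open>?W\<close> below.\<close>
  have "g ` integer_points = integer_points"
    using gZ gg by (metis image_eqI image_subsetI subsetI subset_antisym)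
  moreover have gWW: "g w \<in> ?W" if "w \<in> ?W" for w
    using gW gq gp pW qW that by metis
  have "g ` ?W = ?W"
    using gWW gg by (metis image_eqI image_subsetI subsetI subset_antisym)
  ultimately show thesis
    using that[of g] gq gW by (simp add: lattice_affine_def)
qed

text \<open>Induction on the number of apexes that are not images of apexes; each swap lowers
  it.\<close>

lemma lattice_affine_preserving_apexes:
  fixes f :: "real ^ ('d::finite + 'm::finite) \<Rightarrow> real ^ ('d + 'm)"
  assumes "lattice_affine f" "f ` (embed_base ` S \<union> apexes) = embed_base ` T \<union> apexes"
  shows "\<exists>g. lattice_affine g \<and>
    g ` (embed_base ` S \<union> apexes) = embed_base ` T \<union> (apexes :: (real ^ ('d + 'm)) set) \<and> g ` apexes = apexes"
  using assms
proof (induction "card (apexes - f ` apexes)" arbitrary: f rule: less_induct)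
  case less
  let ?E = "apexes :: (real ^ ('d + 'm)) set"
  have fin: "finite ?E"
    by (simp add: apexes_def)
  have inj: "inj f"
    using lattice_affine_bij[OF less.prems(1)] bij_is_inj by blast
  then have card: "card (f ` ?E) = card ?E"
    by (meson card_image inj_on_subset subset_UNIV)
  show ?case
  proof (cases "f ` ?E = ?E")
    case True
    with less.prems show ?thesis by blast
  next
    case False
    \<comment> \<open>Two distinct finite sets of equal size each contain a point outside the other,
      which supplies both vertices to be swapped.\<close>
    then have "\<not> ?E \<subseteq> f ` ?E" "\<not> f ` ?E \<subseteq> ?E"
      using card fin by (metis card_subset_eq finite_imageI)+
    then obtain p q where p: "p \<in> ?E" "p \<notin> f ` ?E" and q: "q \<in> f ` ?E" "q \<notin> ?E"
      by blast
    obtain g where g: "lattice_affine g" "g ` (embed_base ` T \<union> ?E) = embed_base ` T \<union> ?E"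
      "g q = p" "\<And>w. w \<in> embed_base ` T \<union> ?E \<Longrightarrow> w \<noteq> p \<Longrightarrow> w \<noteq> q \<Longrightarrow> g w = w"
      by (rule swap_apex[OF less.prems q p]) blast
    \<comment> \<open>An apex already hit is neither \<open>p\<close>, which is not hit, nor
      \<open>q\<close>, which is no apex, so the swap fixes it. With \<open>p\<close> gained, the
      set of missed apexes shrinks strictly.\<close>
    have "x \<in> (g \<circ> f) ` ?E" if x: "x \<in> ?E" "x \<in> f ` ?E" for x
    proof -
      have "g x = x"
        using g(4)[of x] x p q by blast
      then show ?thesis
        using x(2) by (metis image_comp image_eqI)
    qed
    moreover have "p \<in> (g \<circ> f) ` ?E"
      using q(1) g(3) by (metis image_comp image_eqI)
    ultimately have "?E - (g \<circ> f) ` ?E \<subset> ?E - f ` ?E"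
      using p by blast
    then have "card (?E - (g \<circ> f) ` ?E) < card (?E - f ` ?E)"
      using fin by (intro psubset_card_mono) auto
    moreover have "(g \<circ> f) ` (embed_base ` S \<union> ?E) = embed_base ` T \<union> ?E"
      using less.prems(2) g(2) by (metis image_comp)
    ultimately show ?thesis
      using less.hyps[of "g \<circ> f"] lattice_affine_compose[OF less.prems(1) g(1)] by blast
  qed
qed

text \<open>An affine map carries affine hulls to affine hulls, and both embedded bases span the
  whole coordinate subspace \<open>range embed_base\<close>. Hence \<open>F\<close> preserves this
  subspace and projecting back by \<open>base_part\<close> loses nothing.\<close>

lemma lattice_affine_restrict:
  fixes F :: "real ^ ('d::finite + 'm::finite) \<Rightarrow> real ^ ('d + 'm)"
  assumes F: "lattice_affine F" and img: "F ` embed_base ` S = embed_base ` T"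
    and S: "affine hull S = UNIV" and T: "affine hull T = UNIV"
  obtains f where "lattice_affine f" "f ` S = T"
proof -
  have lin: "linear (\<lambda>v. F v - F 0)" and FZ: "F ` integer_points = integer_points"
    using F by (simp_all add: lattice_affine_def)
  have hull: "affine hull (embed_base ` X :: (real ^ ('d + 'm)) set) = range embed_base"
    if "affine hull X = UNIV" for X :: "(real ^ 'd) set"
    using affine_hull_linear_image[of "embed_base :: real ^ 'd \<Rightarrow> real ^ ('d + 'm)" X] that
    by (simp add: linear_embed flip: linear_conv_bounded_linear)
  have range: "F ` range embed_base = range embed_base"
    using affine_map_affine_hull[OF lin, of "embed_base ` S"] hull[OF S] hull[OF T] img by simp
  define f where "f x = base_part (F (embed_base x))" for x
  have ef: "embed_base (f x) = F (embed_base x)" for x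
  proof -
    have "F (embed_base x) \<in> range embed_base"
      using range by auto
    then show ?thesis
      by (auto simp: f_def)
  qed
  have "f x - f 0 = (base_part \<circ> ((\<lambda>v. F v - F 0) \<circ> embed_base)) x" for x
    by (simp add: f_def linear_0[OF linear_embed] linear_diff[OF linear_base_part])
  then have "linear (\<lambda>x. f x - f 0)"
    using linear_compose[OF linear_compose[OF linear_embed lin] linear_base_part]
    by (simp add: o_def)
  moreover have "f x \<in> integer_points" if "x \<in> integer_points" for x
    using that FZ unfolding f_def by (intro base_part_integer_points) (auto simp: embed_integer_points)
  moreover have "z \<in> f ` integer_points" if z: "z \<in> integer_points" for z
  proof -
    \<comment> \<open>\<open>embed_base z\<close> has an integer preimage and a preimage in the base
      subspace; injectivity of \<open>F\<close> makes them the same point.\<close>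
    obtain u where u: "u \<in> integer_points" "F u = embed_base z"
      using z FZ iffD2[OF embed_integer_points] by (metis imageE)
    have "embed_base z \<in> F ` range embed_base"
      by (simp add: range)
    then obtain x where x: "F (embed_base x) = embed_base z"
      by auto
    then have "u = embed_base x"
      using u lattice_affine_bij[OF F] by (metis bij_is_inj injD)
    then have "x \<in> integer_points"
      using u(1) by (simp add: embed_integer_points)
    moreover have "f x = z"
      by (simp add: f_def x)
    ultimately show ?thesis
      by blast
  qed
  moreover have "f ` S = T"
  proof -
    have "embed_base ` f ` S = (embed_base ` T :: (real ^ ('d + 'm)) set)"
      using img by (simp add: image_image ef)
    then show ?thesis
      using inj_embed by (metis inj_image_eq_iff)
  qed
  ultimately show thesis
    using that[of f] by (auto simp: lattice_affine_def)
qed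

lemma unimodularly_equivalent_bases:
  fixes S T :: "(real ^ 'd) set"
  assumes S: "\<not> affine_dependent S" "card S = CARD('d) + 1"
    and T: "\<not> affine_dependent T" "card T = CARD('d) + 1"
    and eqv: "unimodularly_equivalent
      (convex hull (embed_base ` S \<union> (apexes :: (real ^ ('d::finite + 'm::finite)) set)))
      (convex hull (embed_base ` T \<union> apexes))"
  shows "unimodularly_equivalent (convex hull S) (convex hull T)"
proof -
  let ?V = "embed_base ` S \<union> (apexes :: (real ^ ('d + 'm)) set)"
  let ?W = "embed_base ` T \<union> (apexes :: (real ^ ('d + 'm)) set)"
  obtain F where F: "lattice_affine F" "F ` (convex hull ?V) = convex hull ?W"
    using eqv by (auto simp: unimodularly_equivalent_iff_lattice_affine)
  have fin: "finite S" "finite T"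
    using S T aff_independent_finite by blast+
  then have finV: "finite ?V"
    by (simp add: apexes_def)
  have hull: "convex hull (F ` ?V) = convex hull ?W"
    using F affine_map_convex_hull[of F ?V] by (simp add: lattice_affine_def)
  \<comment> \<open>Affine independence makes each point of \<open>?W\<close> an extreme point of
    the hull, and extreme points of a hull belong to every set generating it. Comparing
    cardinalities then gives equality.\<close>
  have "?W \<subseteq> F ` ?V"
  proof
    fix w
    assume "w \<in> ?W"
    then have "w extreme_point_of convex hull ?W"
      using extreme_point_of_convex_hull_affine_independent[OF affine_independent_pyramid[OF T(1)]]
      by blast
    then show "w \<in> F ` ?V"
      using extreme_point_of_convex_hull hull by metis
  qed
  moreover have "card (F ` ?V) \<le> card ?W"
    using card_image_le[OF finV, of F] by (simp add: card_pyramid fin S(2) T(2))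
  ultimately have "F ` ?V = ?W"
    using finV by (metis card_seteq finite_imageI)
  from lattice_affine_preserving_apexes[OF F(1) this]
  obtain G where G: "lattice_affine G" "G ` ?V = ?W" "G ` apexes = apexes"
    by (elim exE conjE)
  have disj: "embed_base ` X \<inter> (apexes :: (real ^ ('d + 'm)) set) = {}" for X
    using embed_notin_apexes by auto
  have "inj G"
    using lattice_affine_bij[OF G(1)] bij_is_inj by blast
  \<comment> \<open>Since \<open>G\<close> is injective and preserves the apexes, it also preserves
    their complements in the vertex sets, which are the embedded bases.\<close>
  then have "G ` (?V - apexes) = ?W - apexes"
    using G by (simp only: image_set_diff)
  then have "G ` embed_base ` S = embed_base ` T"
    using disj[of S] disj[of T] by (simp add: Un_Diff Diff_triv)
  \<comment> \<open>An affinely independent set of d + 1 points has affine dimension d, that of the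
    whole space.\<close>
  moreover have "affine hull S = UNIV" "affine hull T = UNIV"
    using aff_dim_affine_independent[OF S(1)] aff_dim_affine_independent[OF T(1)] S(2) T(2)
    by (simp_all flip: aff_dim_eq_full)
  ultimately obtain f where f: "lattice_affine f" "f ` S = T"
    by (rule lattice_affine_restrict[OF G(1)])
  then have "f ` (convex hull S) = convex hull T"
    using affine_map_convex_hull[of f S] by (simp add: lattice_affine_def)
  with f(1) show ?thesis
    by (auto simp: unimodularly_equivalent_iff_lattice_affine)
qed

section \<open>Columns of the matrix as vertices of the simplex\<close>

lemma simplex_columns:
  fixes A :: "real ^ 'k ^ 'd"
  assumes k: "CARD('k) = CARD('d) + 1"
    and simplex: "int CARD('d) simplex (convex hull (columns A))"
  shows "\<not> affine_dependent (columns A) \<and> card (columns A) = CARD('d) + 1"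
proof -
  obtain X where X: "\<not> affine_dependent X" "int (card X) = int CARD('d) + 1"
    "convex hull (columns A) = convex hull X"
    using simplex by (auto simp: simplex_def)
  have cols: "columns A = range (\<lambda>i. column i A)"
    by (auto simp: columns_def)
  \<comment> \<open>The vertices in \<open>X\<close> are extreme points, so they occur among the
    columns. There are at most d + 1 distinct columns and exactly d + 1 vertices, so the two sets
    agree and no column repeats.\<close>
  have "X \<subseteq> columns A"
    using extreme_point_of_convex_hull_affine_independent[OF X(1)] X(3) extreme_point_of_convex_hull
    by (metis subsetI)
  moreover have "card (columns A) \<le> card X"
    using card_image_le[of "UNIV :: 'k set" "\<lambda>i. column i A"] X(2) k cols by simp
  ultimately have "X = columns A"
    using cols by (metis card_seteq finite finite_imageI)
  with X show ?thesis
    by auto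
qed

theorem theorem2p10:
  fixes A B :: "real ^ 'k::finite ^ 'd::finite"
    and C D :: "real ^ ('k::finite + 'm::finite) ^ ('d::finite + 'm)"
  assumes "CARD('k) = CARD('d) + 1"
    and "int CARD('d) simplex (convex hull (columns A))"
    and "integral_polytope (convex hull (columns A))"
    and "int CARD('d) simplex (convex hull (columns B))"
    and "integral_polytope (convex hull (columns B))"
    and "C = block_matrix A 0 0 (mat 1)"
    and "D = block_matrix B 0 0 (mat 1)"
  shows "unimodularly_equivalent (convex hull (columns A)) (convex hull (columns B)) \<longleftrightarrow>
         unimodularly_equivalent (convex hull (columns C)) (convex hull (columns D))"
proof -
  have "\<not> affine_dependent (columns A)" "card (columns A) = CARD('d) + 1"
    "\<not> affine_dependent (columns B)" "card (columns B) = CARD('d) + 1"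
    using simplex_columns[OF assms(1,2)] simplex_columns[OF assms(1,4)] by simp_all
  from unimodularly_equivalent_pyramids unimodularly_equivalent_bases[OF this]
  show ?thesis
    unfolding assms(6,7) columns_pyramid by (rule iffI)
qed

end
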